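(* Let $K$ be a finite simplicial complex with nonempty vertex set and $s\ge1$ an integer. Then for every integer $r\ge1$, \[ \chi^s(K,r)=\sum_{P\in \mathrm{BCP}^s(K)} \chi^1(G_0(P),r), \] and the $s$-chromatic number of $K$ is \[ \chi^s(K)=\min_{P\in\mathrm{BCP}^s(K)} \chi^1(G_0(P)). \]
   Context: An $s$-simplex of $K$ is a face with $s+1$ vertices. An $(r,s)$-coloring of $K$ is a map $V(K)\to\{1,\dots,r\}$ with no monochrome $s$-simplex; $\chi^s(K,r)$ is the number of such colorings and $\chi^s(K)$ the least $r\ge1$ with $\chi^s(K,r)>0$. For a simple graph $G$, $\chi^1(G,r)$ is its usual chromatic polynomial (number of proper vertex colorings with $r$ colors) and $\chi^1(G)$ its chromatic number. A set $B\subseteq V(K)$ is $s$-independent if it contains no $s$-simplex of $K$, and connected if $K\cap D[B]$ (the faces of $K$ contained in $B$) is a connected simplicial complex. A partition of $V(K)$ is block-connected if all its blocks are connected; $\mathrm{BCP}^s(K)$ is the set of block-connected partitions of $V(K)$ all of whose blocks are $s$-independent. For a partition $P$, $G_0(P)$ is the simple graph with vertex set the blocks of $P$, two blocks joined by an edge iff their union is connected. *)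

theory Defs
  imports Main "HOL-Library.Disjoint_Sets" "HOL-Library.FuncSet"
begin

text \<open>
  Closure is required only for nonempty subsets, so that the empty set may or may not be counted
  as a face; every vertex (element of a face) is then itself a face.
\<close>

definition finite_simplicial_complex :: "'a set set \<Rightarrow> bool" where
  "finite_simplicial_complex K \<longleftrightarrow>
     finite K \<and> (\<forall>\<sigma>\<in>K. finite \<sigma>) \<and>
     (\<forall>\<sigma>\<in>K. \<forall>\<tau>. \<tau> \<subseteq> \<sigma> \<and> \<tau> \<noteq> {} \<longrightarrow> \<tau> \<in> K)"

definition vertex_set :: "'a set set \<Rightarrow> 'a set" where
  "vertex_set K = \<Union>K"

definition simplices :: "nat \<Rightarrow> 'a set set \<Rightarrow> 'a set set" where
  "simplices s K = {\<sigma> \<in> K. finite \<sigma> \<and> card \<sigma> = s + 1}"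

definition monochrome :: "('a \<Rightarrow> 'c) \<Rightarrow> 'a set \<Rightarrow> bool" where
  "monochrome f \<sigma> \<longleftrightarrow> (\<exists>c. \<forall>v\<in>\<sigma>. f v = c)"

text \<open>Colorings are extensional functions, so that each map on the vertex set is counted once.\<close>

definition colorings :: "nat \<Rightarrow> 'a set set \<Rightarrow> nat \<Rightarrow> ('a \<Rightarrow> nat) set" where
  "colorings s K r =
     {f \<in> vertex_set K \<rightarrow>\<^sub>E {1..r}. \<not> (\<exists>\<sigma> \<in> simplices s K. monochrome f \<sigma>)}"

definition num_colorings :: "nat \<Rightarrow> 'a set set \<Rightarrow> nat \<Rightarrow> nat" where
  "num_colorings s K r = card (colorings s K r)"

definition chromatic_number :: "nat \<Rightarrow> 'a set set \<Rightarrow> nat" where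
  "chromatic_number s K = (LEAST r. r \<ge> 1 \<and> num_colorings s K r > 0)"

text \<open>A simple graph is a pair of its vertex set and its set of two-element edges.\<close>

type_synonym 'v sgraph = "'v set \<times> 'v set set"

definition proper_colorings :: "'v sgraph \<Rightarrow> nat \<Rightarrow> ('v \<Rightarrow> nat) set" where
  "proper_colorings G r =
     {f \<in> fst G \<rightarrow>\<^sub>E {1..r}. \<forall>u v. u \<noteq> v \<and> {u, v} \<in> snd G \<longrightarrow> f u \<noteq> f v}"

definition graph_num_colorings :: "'v sgraph \<Rightarrow> nat \<Rightarrow> nat" where
  "graph_num_colorings G r = card (proper_colorings G r)"

definition graph_chromatic_number :: "'v sgraph \<Rightarrow> nat" where
  "graph_chromatic_number G = (LEAST r. r \<ge> 1 \<and> graph_num_colorings G r > 0)"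

definition s_independent :: "nat \<Rightarrow> 'a set set \<Rightarrow> 'a set \<Rightarrow> bool" where
  "s_independent s K B \<longleftrightarrow> \<not> (\<exists>\<sigma> \<in> simplices s K. \<sigma> \<subseteq> B)"

definition induced_complex :: "'a set set \<Rightarrow> 'a set \<Rightarrow> 'a set set" where
  "induced_complex K B = {\<sigma> \<in> K. \<sigma> \<subseteq> B}"

text \<open>Connectedness by edge paths: any two vertices are joined by a chain of 1-simplices.\<close>

definition connected_complex :: "'a set set \<Rightarrow> bool" where
  "connected_complex L \<longleftrightarrow>
     (\<forall>u \<in> vertex_set L. \<forall>v \<in> vertex_set L. (u, v) \<in> {(a, b). {a, b} \<in> L}\<^sup>*)"

definition connected_subset :: "'a set set \<Rightarrow> 'a set \<Rightarrow> bool" where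
  "connected_subset K B \<longleftrightarrow> connected_complex (induced_complex K B)"

definition block_connected :: "'a set set \<Rightarrow> 'a set set \<Rightarrow> bool" where
  "block_connected K P \<longleftrightarrow> (\<forall>B \<in> P. connected_subset K B)"

definition BCP :: "nat \<Rightarrow> 'a set set \<Rightarrow> 'a set set set" where
  "BCP s K =
     {P. partition_on (vertex_set K) P \<and> block_connected K P \<and> (\<forall>B \<in> P. s_independent s K B)}"

definition G0 :: "'a set set \<Rightarrow> 'a set set \<Rightarrow> 'a set sgraph" where
  "G0 K P = (P, {{B, C} | B C. B \<in> P \<and> C \<in> P \<and> B \<noteq> C \<and> connected_subset K (B \<union> C)})"

text \<open>
  Consistency of the two notions of coloring: proper colorings of a simple graph are the
  colorings, for \<open>s = 1\<close>, of the graph regarded as a complex of dimension at most one.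
\<close>

lemma proper_colorings_eq_colorings:
  assumes E: "\<And>e. e \<in> E \<Longrightarrow> e \<subseteq> V \<and> card e = 2"
  shows "proper_colorings (V, E) r = colorings 1 ((\<lambda>v. {v}) ` V \<union> E) r"
proof -
  have V: "vertex_set ((\<lambda>v. {v}) ` V \<union> E) = V"
    using E by (auto simp: vertex_set_def)
  have S: "simplices 1 ((\<lambda>v. {v}) ` V \<union> E) = E"
    using E by (auto simp: simplices_def intro: card_ge_0_finite)
  have "(\<forall>u v. u \<noteq> v \<and> {u, v} \<in> E \<longrightarrow> f u \<noteq> f v) \<longleftrightarrow> \<not> (\<exists>\<sigma> \<in> E. monochrome f \<sigma>)"
    for f :: "'a \<Rightarrow> nat"
  proof
    assume L: "\<forall>u v. u \<noteq> v \<and> {u, v} \<in> E \<longrightarrow> f u \<noteq> f v"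
    show "\<not> (\<exists>\<sigma> \<in> E. monochrome f \<sigma>)"
    proof
      assume "\<exists>\<sigma> \<in> E. monochrome f \<sigma>"
      then obtain e where e: "e \<in> E" "monochrome f e" by blast
      then obtain u v where "e = {u, v}" "u \<noteq> v" using E by (meson card_2_iff)
      with e L show False by (metis insertCI monochrome_def)
    qed
  next
    assume "\<not> (\<exists>\<sigma> \<in> E. monochrome f \<sigma>)"
    then show "\<forall>u v. u \<noteq> v \<and> {u, v} \<in> E \<longrightarrow> f u \<noteq> f v"
      by (auto simp: monochrome_def)
  qed
  then show ?thesis
    unfolding proper_colorings_def colorings_def V S by simp
qed

text \<open>The index set of the sum and of the minimum is finite and nonempty.\<close>

lemma finite_BCP:
  assumes "finite_simplicial_complex K"
  shows "finite (BCP s K)"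
proof (rule finite_subset)
  show "BCP s K \<subseteq> Pow (Pow (vertex_set K))"
    by (auto simp: BCP_def partition_on_def)
  show "finite (Pow (Pow (vertex_set K)))"
    using assms by (auto simp: finite_simplicial_complex_def vertex_set_def)
qed

lemma BCP_nonempty:
  assumes "s \<ge> 1"
  shows "BCP s K \<noteq> {}"
proof -
  have "partition_on (vertex_set K) ((\<lambda>v. {v}) ` vertex_set K)"
    by (auto intro!: partition_onI simp: disjnt_def)
  moreover have "block_connected K ((\<lambda>v. {v}) ` vertex_set K)"
    by (auto simp: block_connected_def connected_subset_def connected_complex_def
        induced_complex_def vertex_set_def)
  moreover have "s_independent s K {v}" for v
    using assms by (auto simp: s_independent_def simplices_def dest!: subset_singletonD)
  ultimately have "(\<lambda>v. {v}) ` vertex_set K \<in> BCP s K"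
    by (auto simp: BCP_def)
  then show ?thesis by blast
qed

end

theory Submission
  imports Defs
begin

text \<open>
  Every coloring splits the vertex set into its monochrome components, the classes of the relation
  generated by the edges with equally colored endpoints. For an \<open>(r,s)\<close>-coloring this is a partition
  in \<open>BCP s K\<close>, and the coloring induces a proper coloring of \<open>G0 K P\<close>, since two
  blocks of the same color with connected union would lie in one component. Conversely, a proper
  coloring of \<open>G0 K P\<close> pulls back to a coloring of the vertices whose monochrome components
  are exactly the blocks of \<open>P\<close>. The formula for the chromatic number follows because the sum is
  positive iff one of its terms is.
\<close>

section \<open>Monochrome components and the two mutually inverse maps\<close>

definition mono_edges :: "'a set set \<Rightarrow> ('a \<Rightarrow> 'c) \<Rightarrow> ('a \<times> 'a) set" where
  "mono_edges K f = {(a, b). {a, b} \<in> K \<and> f a = f b}"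

text \<open>The reflexive-transitive closure relates every element of the type to itself; cutting it
  down to \<open>vertex_set K\<close> gives an equivalence relation on that set.\<close>

definition mono_rel :: "'a set set \<Rightarrow> ('a \<Rightarrow> 'c) \<Rightarrow> ('a \<times> 'a) set" where
  "mono_rel K f = (mono_edges K f)\<^sup>* \<inter> vertex_set K \<times> vertex_set K"

definition mono_components :: "'a set set \<Rightarrow> ('a \<Rightarrow> 'c) \<Rightarrow> 'a set set" where
  "mono_components K f = vertex_set K // mono_rel K f"

text \<open>The partition is kept next to its coloring so that the values lie in a disjoint union
  over partitions. \<open>restrict\<close> makes the coloring extensional, as
  \<open>proper_colorings\<close> demands.\<close>

definition block_coloring :: "'a set set \<Rightarrow> ('a \<Rightarrow> nat) \<Rightarrow> 'a set set \<times> ('a set \<Rightarrow> nat)" where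
  "block_coloring K f = (mono_components K f,
     restrict (\<lambda>B. f (SOME v. v \<in> B)) (mono_components K f))"

text \<open>The description picks the block of \<open>v\<close>, which is unique once
  \<open>P\<close> is a partition.\<close>

definition pullback_coloring :: "'a set set \<Rightarrow> 'a set set \<times> ('a set \<Rightarrow> nat) \<Rightarrow> 'a \<Rightarrow> nat" where
  "pullback_coloring K = (\<lambda>(P, g). restrict (\<lambda>v. g (THE B. B \<in> P \<and> v \<in> B)) (vertex_set K))"

lemma partition_on_block_unique:
  "partition_on A P \<Longrightarrow> B \<in> P \<Longrightarrow> C \<in> P \<Longrightarrow> x \<in> B \<Longrightarrow> x \<in> C \<Longrightarrow> B = C"
  by (auto simp: partition_on_def disjoint_def)

lemma partition_on_obtain_element:
  assumes "partition_on A P" "B \<in> P"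
  obtains x where "x \<in> B"
  using partition_onD3[OF assms(1)] assms(2) by (metis all_not_in_conv)

text \<open>An edge \<open>{u, v}\<close> can be read in either order, but both readings give the
  same condition because union is commutative.\<close>

lemma proper_colorings_G0_iff:
  "g \<in> proper_colorings (G0 K P) r \<longleftrightarrow> g \<in> P \<rightarrow>\<^sub>E {1..r} \<and>
    (\<forall>B\<in>P. \<forall>C\<in>P. B \<noteq> C \<and> connected_subset K (B \<union> C) \<longrightarrow> g B \<noteq> g C)"
proof -
  have "{u, v} \<in> snd (G0 K P) \<longleftrightarrow> u \<in> P \<and> v \<in> P \<and> u \<noteq> v \<and> connected_subset K (u \<union> v)" for u v
    unfolding G0_def snd_conv mem_Collect_eq doubleton_eq_iff by (metis Un_commute)
  then show ?thesis
    unfolding proper_colorings_def by (simp add: G0_def) blast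
qed

subsection \<open>Connected subsets\<close>

lemma edge_in_vertex_set: "{a, b} \<in> K \<Longrightarrow> a \<in> vertex_set K \<and> b \<in> vertex_set K"
  by (auto simp: vertex_set_def)

lemma singleton_in_complex:
  "finite_simplicial_complex K \<Longrightarrow> v \<in> vertex_set K \<Longrightarrow> {v} \<in> K"
  unfolding finite_simplicial_complex_def vertex_set_def by blast

lemma finite_vertex_set: "finite_simplicial_complex K \<Longrightarrow> finite (vertex_set K)"
  by (auto simp: finite_simplicial_complex_def vertex_set_def)

lemma vertex_set_induced:
  assumes "finite_simplicial_complex K" "B \<subseteq> vertex_set K"
  shows "vertex_set (induced_complex K B) = B"
proof
  show "vertex_set (induced_complex K B) \<subseteq> B"
    by (auto simp: vertex_set_def induced_complex_def)
  show "B \<subseteq> vertex_set (induced_complex K B)"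
  proof
    fix v assume "v \<in> B"
    then have "{v} \<in> induced_complex K B"
      using assms(2) singleton_in_complex[OF assms(1)] by (auto simp: induced_complex_def)
    then show "v \<in> vertex_set (induced_complex K B)"
      by (auto simp: vertex_set_def)
  qed
qed

text \<open>Closure of \<open>K\<close> under nonempty subsets makes every element of
  \<open>B\<close> a vertex of the induced complex, so connectedness amounts to paths in
  \<open>K\<close> that stay inside \<open>B\<close>.\<close>

lemma connected_subset_iff:
  assumes "finite_simplicial_complex K" "B \<subseteq> vertex_set K"
  shows "connected_subset K B \<longleftrightarrow>
    (\<forall>u\<in>B. \<forall>v\<in>B. (u, v) \<in> {(a, b). {a, b} \<in> K \<and> a \<in> B \<and> b \<in> B}\<^sup>*)"
proof -
  have "{(a, b). {a, b} \<in> induced_complex K B} = {(a, b). {a, b} \<in> K \<and> a \<in> B \<and> b \<in> B}"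
    by (auto simp: induced_complex_def)
  then show ?thesis
    by (simp add: connected_subset_def connected_complex_def vertex_set_induced[OF assms])
qed

text \<open>The edge \<open>{a, b}\<close> is a bridge: each point of \<open>B\<close> reaches
  \<open>a\<close>, each point of \<open>C\<close> reaches \<open>b\<close> and hence
  \<open>a\<close>, and path reversal joins any two points through \<open>a\<close>.\<close>

lemma connected_subset_Un:
  assumes K: "finite_simplicial_complex K"
    and B: "B \<subseteq> vertex_set K" "connected_subset K B"
    and C: "C \<subseteq> vertex_set K" "connected_subset K C"
    and ab: "{a, b} \<in> K" "a \<in> B" "b \<in> C"
  shows "connected_subset K (B \<union> C)"
proof -
  let ?E = "\<lambda>X. {(x, y). {x, y} \<in> K \<and> x \<in> X \<and> y \<in> X}"
  have mB: "(?E B)\<^sup>* \<subseteq> (?E (B \<union> C))\<^sup>*" and mC: "(?E C)\<^sup>* \<subseteq> (?E (B \<union> C))\<^sup>*"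
    by (rule rtrancl_mono; blast)+
  have sym: "sym ((?E (B \<union> C))\<^sup>*)"
    by (rule sym_rtrancl) (auto simp: sym_def insert_commute)
  have "(a, b) \<in> (?E (B \<union> C))\<^sup>*"
    using ab by blast
  moreover have "(x, a) \<in> (?E (B \<union> C))\<^sup>*" if "x \<in> B" for x
    using that ab mB B(2) connected_subset_iff[OF K B(1)] by blast
  moreover have "(x, b) \<in> (?E (B \<union> C))\<^sup>*" if "x \<in> C" for x
    using that ab mC C(2) connected_subset_iff[OF K C(1)] by blast
  ultimately have to_a: "(x, a) \<in> (?E (B \<union> C))\<^sup>*" if "x \<in> B \<union> C" for x
    using that sym by (meson UnE rtrancl_trans symD)
  have "(x, y) \<in> (?E (B \<union> C))\<^sup>*" if "x \<in> B \<union> C" "y \<in> B \<union> C" for x y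
    using to_a[OF that(1)] symD[OF sym to_a[OF that(2)]] by (rule rtrancl_trans)
  then show ?thesis
    using connected_subset_iff[OF K, of "B \<union> C"] B(1) C(1) by blast
qed

text \<open>A path inside \<open>B\<close> uses only edges with equally colored ends. This serves
  both for a single block of a partition and for the union of two components that share a
  color.\<close>

lemma connected_const_mono_rel:
  assumes K: "finite_simplicial_complex K" and B: "B \<subseteq> vertex_set K" "connected_subset K B"
    and c: "\<And>v. v \<in> B \<Longrightarrow> f v = c" and uv: "u \<in> B" "v \<in> B"
  shows "(u, v) \<in> mono_rel K f"
proof -
  have "{(a, b). {a, b} \<in> K \<and> a \<in> B \<and> b \<in> B}\<^sup>* \<subseteq> (mono_edges K f)\<^sup>*"
    by (rule rtrancl_mono) (auto simp: mono_edges_def c)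
  then show ?thesis
    using connected_subset_iff[OF K B(1)] B uv by (auto simp: mono_rel_def)
qed

subsection \<open>Monochrome components\<close>

lemma equiv_mono_rel: "equiv (vertex_set K) (mono_rel K f)"
proof (rule equivI)
  have "sym (mono_edges K f)"
    by (auto simp: sym_def mono_edges_def insert_commute)
  then have "sym ((mono_edges K f)\<^sup>*)"
    by (rule sym_rtrancl)
  then show "sym (mono_rel K f)"
    by (auto simp: mono_rel_def sym_def)
  show "trans (mono_rel K f)"
    by (auto simp: mono_rel_def intro!: transI)
qed (auto simp: mono_rel_def refl_on_def)

lemma mono_rel_color: "(u, v) \<in> mono_rel K f \<Longrightarrow> f u = f v"
proof -
  have "(u, v) \<in> (mono_edges K f)\<^sup>* \<Longrightarrow> f u = f v"
    by (induction rule: rtrancl_induct) (auto simp: mono_edges_def)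
  then show "(u, v) \<in> mono_rel K f \<Longrightarrow> f u = f v"
    by (simp add: mono_rel_def)
qed

lemma partition_mono_components: "partition_on (vertex_set K) (mono_components K f)"
  unfolding mono_components_def by (rule partition_on_quotient[OF equiv_mono_rel])

lemma mono_component_rel:
  "B \<in> mono_components K f \<Longrightarrow> u \<in> B \<Longrightarrow> v \<in> B \<Longrightarrow> (u, v) \<in> mono_rel K f"
  unfolding mono_components_def using quotient_eq_iff[OF equiv_mono_rel, of B K f B u v] by simp

lemma rel_mono_component:
  "B \<in> mono_components K f \<Longrightarrow> u \<in> B \<Longrightarrow> (u, v) \<in> mono_rel K f \<Longrightarrow> v \<in> B"
  unfolding mono_components_def by (rule in_quotient_imp_closed[OF equiv_mono_rel])

lemma mono_component_subset: "B \<in> mono_components K f \<Longrightarrow> B \<subseteq> vertex_set K"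
  using partition_onD1[OF partition_mono_components[of K f]] by auto

lemma connected_mono_component:
  assumes K: "finite_simplicial_complex K" and B: "B \<in> mono_components K f"
  shows "connected_subset K B"
proof -
  have "(u, v) \<in> {(a, b). {a, b} \<in> K \<and> a \<in> B \<and> b \<in> B}\<^sup>*" if u: "u \<in> B" and v: "v \<in> B" for u v
  proof -
    have "(u, v) \<in> (mono_edges K f)\<^sup>*"
      using mono_component_rel[OF B u v] by (simp add: mono_rel_def)
    \<comment> \<open>Membership of the endpoint in \<open>B\<close> is carried through the
      induction: a component is closed under \<open>mono_rel\<close>, so a monochrome path starting
      in it never leaves it.\<close>
    then have "v \<in> B \<and> (u, v) \<in> {(a, b). {a, b} \<in> K \<and> a \<in> B \<and> b \<in> B}\<^sup>*"
    proof (induction rule: rtrancl_induct)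
      case base
      then show ?case using u by simp
    next
      case (step y z)
      have "(y, z) \<in> mono_rel K f" "{y, z} \<in> K"
        using step.hyps(2) edge_in_vertex_set[of y z K] by (auto simp: mono_rel_def mono_edges_def)
      then have "z \<in> B"
        using rel_mono_component[OF B] step.IH by blast
      then show ?case
        using step.IH \<open>{y, z} \<in> K\<close> by (auto intro: rtrancl_into_rtrancl)
    qed
    then show ?thesis by simp
  qed
  then show ?thesis
    using connected_subset_iff[OF K mono_component_subset[OF B]] by blast
qed

text \<open>\<open>f\<close> is constant on a component, so the representative chosen by
  \<open>SOME\<close> does not matter.\<close>

lemma block_coloring_apply:
  assumes "B \<in> mono_components K f" "v \<in> B"
  shows "snd (block_coloring K f) B = f v"
proof -
  have "(SOME v. v \<in> B) \<in> B"
    using assms(2) by (rule someI)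
  then have "f (SOME v. v \<in> B) = f v"
    using mono_rel_color[OF mono_component_rel[OF assms(1)]] assms(2) by blast
  then show ?thesis
    using assms(1) by (simp add: block_coloring_def)
qed

lemma mono_components_in_BCP:
  assumes K: "finite_simplicial_complex K" and f: "f \<in> colorings s K r"
  shows "mono_components K f \<in> BCP s K"
proof -
  have "s_independent s K B" if B: "B \<in> mono_components K f" for B
    unfolding s_independent_def
  proof
    assume "\<exists>\<sigma>\<in>simplices s K. \<sigma> \<subseteq> B"
    then obtain \<sigma> where \<sigma>: "\<sigma> \<in> simplices s K" "\<sigma> \<subseteq> B" by blast
    then have "monochrome f \<sigma>"
      unfolding monochrome_def using block_coloring_apply[OF B] by (metis subsetD)
    then show False
      using f \<sigma> by (auto simp: colorings_def)
  qed
  then show ?thesis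
    using partition_mono_components connected_mono_component[OF K]
    by (auto simp: BCP_def block_connected_def)
qed

lemma block_coloring_proper:
  assumes K: "finite_simplicial_complex K" and f: "f \<in> colorings s K r"
  shows "snd (block_coloring K f) \<in> proper_colorings (G0 K (mono_components K f)) r"
proof -
  let ?P = "mono_components K f" and ?g = "snd (block_coloring K f)"
  have ne: "B \<noteq> {}" if "B \<in> ?P" for B
    using that partition_mono_components by (auto simp: partition_on_def)
  have "?g B \<in> {1..r}" if B: "B \<in> ?P" for B
  proof -
    obtain v where "v \<in> B" using ne[OF B] by blast
    then show ?thesis
      using block_coloring_apply[OF B] mono_component_subset[OF B] f
      by (auto simp: colorings_def PiE_iff)
  qed
  then have "?g \<in> ?P \<rightarrow>\<^sub>E {1..r}"
    by (auto simp: block_coloring_def)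
  moreover have "?g B \<noteq> ?g C"
    if B: "B \<in> ?P" and C: "C \<in> ?P" and "B \<noteq> C" and con: "connected_subset K (B \<union> C)" for B C
  proof
    assume eq: "?g B = ?g C"
    have sub: "B \<union> C \<subseteq> vertex_set K"
      using mono_component_subset B C by blast
    \<comment> \<open>Equal block colors make \<open>f\<close> constant on the whole union;
      connectedness then relates a vertex of \<open>B\<close> to a vertex of \<open>C\<close>, so
      the two components meet and coincide.\<close>
    have const: "f v = ?g B" if "v \<in> B \<union> C" for v
      using that block_coloring_apply[OF B] block_coloring_apply[OF C] eq by auto
    obtain u v where uv: "u \<in> B" "v \<in> C" using ne B C by blast
    have "(u, v) \<in> mono_rel K f"
      by (rule connected_const_mono_rel[OF K sub con const]) (use uv in auto)
    then have "v \<in> B"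
      using rel_mono_component[OF B] uv by blast
    then show False
      using partition_on_block_unique[OF partition_mono_components] B C uv \<open>B \<noteq> C\<close> by metis
  qed
  ultimately show ?thesis
    unfolding proper_colorings_G0_iff by blast
qed

subsection \<open>Pulling back proper colorings of the block graph\<close>

context
  fixes K :: "'a set set" and s r :: nat and P :: "'a set set" and g :: "'a set \<Rightarrow> nat"
  assumes K: "finite_simplicial_complex K"
    and P: "P \<in> BCP s K"
    and g: "g \<in> proper_colorings (G0 K P) r"
begin

lemma BCP_partition: "partition_on (vertex_set K) P"
  using P by (simp add: BCP_def)

lemma BCP_block_subset: "B \<in> P \<Longrightarrow> B \<subseteq> vertex_set K"
  using BCP_partition by (auto simp: partition_on_def)

lemma BCP_block_connected: "B \<in> P \<Longrightarrow> connected_subset K B"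
  using P by (simp add: BCP_def block_connected_def)

lemma pullback_apply:
  assumes "B \<in> P" "v \<in> B"
  shows "pullback_coloring K (P, g) v = g B"
proof -
  have "(THE C. C \<in> P \<and> v \<in> C) = B"
    using assms partition_on_block_unique[OF BCP_partition] by (intro the_equality) auto
  then show ?thesis
    using assms BCP_block_subset by (auto simp: pullback_coloring_def)
qed

text \<open>An edge of \<open>K\<close> between different blocks makes their union connected, so the
  blocks are adjacent in \<open>G0 K P\<close> and \<open>g\<close> separates them. Both the
  validity of the pulled-back coloring and the recovery of \<open>P\<close> from it rest on
  this.\<close>

lemma pullback_edge_same_block:
  assumes ab: "{a, b} \<in> K" "a \<in> B" "b \<in> C" and BC: "B \<in> P" "C \<in> P"
    and eq: "pullback_coloring K (P, g) a = pullback_coloring K (P, g) b"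
  shows "B = C"
proof (rule ccontr)
  assume "B \<noteq> C"
  moreover have "connected_subset K (B \<union> C)"
    using connected_subset_Un[OF K _ _ _ _ ab] BC BCP_block_subset BCP_block_connected by blast
  ultimately have "g B \<noteq> g C"
    using g BC unfolding proper_colorings_G0_iff by blast
  then show False
    using eq ab BC pullback_apply by metis
qed

lemma obtain_block:
  assumes "v \<in> vertex_set K"
  obtains B where "B \<in> P" "v \<in> B"
  using assms BCP_partition by (auto simp: partition_on_def)

lemma pullback_in_colorings: "pullback_coloring K (P, g) \<in> colorings s K r"
proof -
  let ?f = "pullback_coloring K (P, g)"
  have "?f v \<in> {1..r}" if v: "v \<in> vertex_set K" for v
  proof -
    obtain B where "B \<in> P" "v \<in> B" using obtain_block[OF v] .
    then show ?thesis
      using pullback_apply g by (auto simp: proper_colorings_G0_iff PiE_iff)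
  qed
  then have "?f \<in> vertex_set K \<rightarrow>\<^sub>E {1..r}"
    by (auto simp: pullback_coloring_def)
  moreover have "\<not> monochrome ?f \<sigma>" if \<sigma>: "\<sigma> \<in> simplices s K" for \<sigma>
  proof
    assume mono: "monochrome ?f \<sigma>"
    have \<sigma>K: "\<sigma> \<in> K" "\<sigma> \<noteq> {}" "\<sigma> \<subseteq> vertex_set K"
      using \<sigma> by (auto simp: simplices_def vertex_set_def)
    then obtain a where a: "a \<in> \<sigma>" by blast
    then obtain B where B: "B \<in> P" "a \<in> B" using obtain_block \<sigma>K by blast
    \<comment> \<open>Any two vertices of a simplex span a face of \<open>K\<close>, so a monochrome
      simplex lies wholly in the block of any of its vertices, against the s-independence of that
      block.\<close>
    have "b \<in> B" if b: "b \<in> \<sigma>" for b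
    proof -
      obtain C where C: "C \<in> P" "b \<in> C" using obtain_block \<sigma>K b by blast
      have "{a, b} \<subseteq> \<sigma>" "{a, b} \<noteq> {}" using a b by auto
      then have "{a, b} \<in> K"
        using K \<sigma>K(1) unfolding finite_simplicial_complex_def by blast
      moreover have "?f a = ?f b"
        using mono a b by (auto simp: monochrome_def)
      ultimately show ?thesis
        using pullback_edge_same_block B C by blast
    qed
    then have "\<sigma> \<subseteq> B" by blast
    then show False
      using P B \<sigma> by (auto simp: BCP_def s_independent_def)
  qed
  ultimately show ?thesis
    by (auto simp: colorings_def)
qed

lemma mono_components_pullback: "mono_components K (pullback_coloring K (P, g)) = P"
proof -
  let ?f = "pullback_coloring K (P, g)"
  \<comment> \<open>A monochrome path cannot cross from one block to another, and conversely a block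
    is connected and carries the single color given by \<open>g\<close>. The quotient by the
    same-block relation is \<open>P\<close> itself.\<close>
  have "mono_rel K ?f = {(x, y). \<exists>B\<in>P. x \<in> B \<and> y \<in> B}"
  proof (intro equalityI subrelI)
    fix u v assume uv: "(u, v) \<in> mono_rel K ?f"
    then obtain B where B: "B \<in> P" "u \<in> B"
      using obtain_block by (auto simp: mono_rel_def)
    have "(u, v) \<in> (mono_edges K ?f)\<^sup>*"
      using uv by (simp add: mono_rel_def)
    then have "v \<in> B"
    proof (induction rule: rtrancl_induct)
      case (step y z)
      then have yz: "{y, z} \<in> K" "?f y = ?f z"
        by (auto simp: mono_edges_def)
      then obtain C where "C \<in> P" "z \<in> C"
        using obtain_block edge_in_vertex_set by metis
      then show ?case
        using pullback_edge_same_block yz step.IH B by blast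
    qed (use B in simp)
    then show "(u, v) \<in> {(x, y). \<exists>B\<in>P. x \<in> B \<and> y \<in> B}"
      using B by blast
  next
    fix u v assume "(u, v) \<in> {(x, y). \<exists>B\<in>P. x \<in> B \<and> y \<in> B}"
    then obtain B where B: "B \<in> P" "u \<in> B" "v \<in> B" by blast
    show "(u, v) \<in> mono_rel K ?f"
      by (rule connected_const_mono_rel[OF K BCP_block_subset[OF B(1)] BCP_block_connected[OF B(1)]
            pullback_apply[OF B(1)] B(2,3)])
  qed
  then show ?thesis
    using partition_on_eq_quotient[OF BCP_partition] by (simp add: mono_components_def)
qed

lemma block_coloring_pullback: "block_coloring K (pullback_coloring K (P, g)) = (P, g)"
proof -
  let ?f = "pullback_coloring K (P, g)"
  have "snd (block_coloring K ?f) B = g B" for B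
  proof (cases "B \<in> P")
    case True
    then obtain v where v: "v \<in> B"
      using partition_on_obtain_element[OF BCP_partition] by blast
    then show ?thesis
      using block_coloring_apply[of B K ?f v] True pullback_apply
      by (simp add: mono_components_pullback)
  next
    \<comment> \<open>Off \<open>P\<close> both functions are \<open>undefined\<close>: one by
      \<open>restrict\<close>, the other by extensionality of \<open>g\<close>.\<close>
    case False
    then show ?thesis
      using g by (auto simp: block_coloring_def mono_components_pullback proper_colorings_G0_iff
          PiE_iff extensional_def)
  qed
  then have "snd (block_coloring K ?f) = g" ..
  moreover have "fst (block_coloring K ?f) = P"
    by (simp add: block_coloring_def mono_components_pullback)
  ultimately show ?thesis
    by (metis prod.collapse)
qed

end

lemma pullback_block_coloring:
  assumes K: "finite_simplicial_complex K" and f: "f \<in> colorings s K r"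
  shows "pullback_coloring K (block_coloring K f) = f"
proof
  fix v
  let ?P = "mono_components K f" and ?g = "snd (block_coloring K f)"
  have pair: "block_coloring K f = (?P, ?g)"
    by (simp add: block_coloring_def)
  show "pullback_coloring K (block_coloring K f) v = f v"
  proof (cases "v \<in> vertex_set K")
    case True
    then obtain B where B: "B \<in> ?P" "v \<in> B"
      using partition_mono_components[of K f] by (auto simp: partition_on_def)
    have "pullback_coloring K (?P, ?g) v = ?g B"
      using pullback_apply[OF K mono_components_in_BCP[OF K f] block_coloring_proper[OF K f] B] .
    then show ?thesis
      using block_coloring_apply[OF B] pair by simp
  next
    case False
    then show ?thesis
      using f by (auto simp: pullback_coloring_def colorings_def PiE_iff extensional_def
          split: prod.splits)
  qed
qed

subsection \<open>Counting\<close>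

lemma bij_betw_block_coloring:
  assumes K: "finite_simplicial_complex K"
  shows "bij_betw (block_coloring K) (colorings s K r)
    (SIGMA P:BCP s K. proper_colorings (G0 K P) r)"
proof (rule bij_betw_byWitness[where f' = "pullback_coloring K"])
  show "\<forall>f\<in>colorings s K r. pullback_coloring K (block_coloring K f) = f"
    using pullback_block_coloring[OF K] by blast
  show "\<forall>x\<in>SIGMA P:BCP s K. proper_colorings (G0 K P) r.
      block_coloring K (pullback_coloring K x) = x"
    using block_coloring_pullback[OF K] by blast
  show "block_coloring K ` colorings s K r \<subseteq> (SIGMA P:BCP s K. proper_colorings (G0 K P) r)"
    using mono_components_in_BCP[OF K] block_coloring_proper[OF K]
    by (force simp: block_coloring_def)
  show "pullback_coloring K ` (SIGMA P:BCP s K. proper_colorings (G0 K P) r) \<subseteq> colorings s K r"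
    using pullback_in_colorings[OF K] by blast
qed

lemma finite_BCP_blocks:
  assumes "finite_simplicial_complex K" "P \<in> BCP s K"
  shows "finite P"
  using finite_elements[OF finite_vertex_set[OF assms(1)]] assms(2) unfolding BCP_def by blast

lemma finite_proper_colorings: "finite (fst G) \<Longrightarrow> finite (proper_colorings G r)"
  unfolding proper_colorings_def by (simp add: finite_PiE)

lemma num_colorings_eq_sum:
  assumes K: "finite_simplicial_complex K"
  shows "num_colorings s K r = (\<Sum>P\<in>BCP s K. graph_num_colorings (G0 K P) r)"
proof -
  \<comment> \<open>The cardinality of the dependent sum splits into a sum of cardinalities once the
    index set and every fibre are finite.\<close>
  have "finite (proper_colorings (G0 K P) r)" if "P \<in> BCP s K" for P
    using finite_BCP_blocks[OF K that] by (intro finite_proper_colorings) (simp add: G0_def)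
  then show ?thesis
    using bij_betw_same_card[OF bij_betw_block_coloring[OF K]] finite_BCP[OF K]
    by (simp add: num_colorings_def graph_num_colorings_def)
qed

section \<open>Chromatic numbers as least values\<close>

lemma graph_num_colorings_G0_pos:
  assumes fin: "finite P"
  shows "graph_num_colorings (G0 K P) (Suc (card P)) > 0"
proof -
  obtain h where h: "bij_betw h P {0..<card P}"
    using ex_bij_betw_finite_nat[OF fin] by blast
  then have "h B < card P" if "B \<in> P" for B
    using that by (auto simp: bij_betw_def)
  moreover have "h B \<noteq> h C" if "B \<in> P" "C \<in> P" "B \<noteq> C" for B C
    using h that by (auto simp: bij_betw_def inj_on_def)
  \<comment> \<open>Giving all blocks distinct colors is always proper. \<open>Suc\<close> shifts
    the values of \<open>h\<close> to colors starting at 1; the palette size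
    \<open>Suc (card P)\<close>, one more than the number of colors used, is at least 1 whatever
    \<open>P\<close> is.\<close>
  ultimately have "restrict (Suc \<circ> h) P \<in> proper_colorings (G0 K P) (Suc (card P))"
    unfolding proper_colorings_G0_iff by (auto simp: PiE_iff Suc_le_eq intro: less_SucI)
  moreover have "finite (proper_colorings (G0 K P) (Suc (card P)))"
    using fin by (intro finite_proper_colorings) (simp add: G0_def)
  ultimately show ?thesis
    by (auto simp: graph_num_colorings_def card_gt_0_iff)
qed

text \<open>The minimum is attained at some \<open>x\<close>, where \<open>ex\<close> ensures that
  the least value satisfies \<open>Q x\<close>; conversely, any \<open>r\<close> with a witness
  \<open>x\<close> is bounded below by the least value for that \<open>x\<close>.\<close>

lemma Least_bex_eq_Min:
  fixes Q :: "'b \<Rightarrow> nat \<Rightarrow> bool"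
  assumes fin: "finite A" and ne: "A \<noteq> {}" and ex: "\<And>x. x \<in> A \<Longrightarrow> \<exists>r. Q x r"
  shows "(LEAST r. \<exists>x\<in>A. Q x r) = Min ((\<lambda>x. LEAST r. Q x r) ` A)"
proof (rule Least_equality)
  have "Min ((\<lambda>x. LEAST r. Q x r) ` A) \<in> (\<lambda>x. LEAST r. Q x r) ` A"
    using fin ne by simp
  then obtain x where "x \<in> A" "Min ((\<lambda>x. LEAST r. Q x r) ` A) = (LEAST r. Q x r)"
    by blast
  then show "\<exists>x\<in>A. Q x (Min ((\<lambda>x. LEAST r. Q x r) ` A))"
    using ex[of x] by (metis LeastI_ex)
next
  fix r assume "\<exists>x\<in>A. Q x r"
  then obtain x where x: "x \<in> A" "Q x r" by blast
  have "Min ((\<lambda>x. LEAST r. Q x r) ` A) \<le> (LEAST r. Q x r)"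
    using fin x by simp
  also have "\<dots> \<le> r"
    using x(2) by (rule Least_le)
  finally show "Min ((\<lambda>x. LEAST r. Q x r) ` A) \<le> r" .
qed

theorem theorem2p5:
  fixes K :: "'a set set" and s :: nat
  assumes "finite_simplicial_complex K"
    and "vertex_set K \<noteq> {}"
    and "s \<ge> 1"
  shows "(\<forall>r::nat. r \<ge> 1 \<longrightarrow>
            num_colorings s K r = (\<Sum>P \<in> BCP s K. graph_num_colorings (G0 K P) r)) \<and>
         chromatic_number s K = Min ((\<lambda>P. graph_chromatic_number (G0 K P)) ` BCP s K)"
proof -
  note K = assms(1)
  \<comment> \<open>A finite sum of natural numbers is zero iff all its terms are.\<close>
  have "num_colorings s K r > 0 \<longleftrightarrow> (\<exists>P\<in>BCP s K. graph_num_colorings (G0 K P) r > 0)" for r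
    using finite_BCP[OF K] unfolding num_colorings_eq_sum[OF K] neq0_conv[symmetric] by simp
  \<comment> \<open>The bound \<open>r \<ge> 1\<close> moves inside the quantifier so that the least
    value for each fixed \<open>P\<close> is \<open>graph_chromatic_number (G0 K P)\<close>.\<close>
  then have "chromatic_number s K =
      (LEAST r. \<exists>P\<in>BCP s K. r \<ge> 1 \<and> graph_num_colorings (G0 K P) r > 0)"
    unfolding chromatic_number_def by (intro arg_cong[where f = Least]) auto
  also have "\<dots> = Min ((\<lambda>P. graph_chromatic_number (G0 K P)) ` BCP s K)"
    unfolding graph_chromatic_number_def
  proof (rule Least_bex_eq_Min[OF finite_BCP[OF K] BCP_nonempty[OF assms(3)]])
    fix P assume "P \<in> BCP s K"
    then have "graph_num_colorings (G0 K P) (Suc (card P)) > 0"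
      using graph_num_colorings_G0_pos finite_BCP_blocks[OF K] by blast
    then show "\<exists>r\<ge>1. graph_num_colorings (G0 K P) r > 0"
      by (intro exI[of _ "Suc (card P)"]) simp
  qed
  finally show ?thesis
    using num_colorings_eq_sum[OF K] by blast
qed

end
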